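(* Let $\mathbb{F}$ be a field of characteristic $0$. Suppose that $g(x)=g_0+g_1x+g_2x^2+\cdots\in\mathbb{F}_0[[x]]$, where $g_0$ has finite order $\mathrm{ord}(g_0)$ in the multiplicative group $\mathbb{F}\setminus\{0\}$, and that $F(x)=\omega x+F_2x^2+\cdots$ is an element of finite (compositional) order $\mathrm{ord}(F(x))$ in $\mathbb{F}_1[[x]]$. Let $n$ be a positive integer. Then $\big(g(x),F(x)\big)$ has finite order $n$ in the Riordan group $\mathcal{R}(\mathbb{F})$ if and only if both of the following hold: (1) $n=\mathrm{lcm}\big(\mathrm{ord}(g_0),\mathrm{ord}(F(x))\big)=\mathrm{lcm}\big(\mathrm{ord}(g_0),\mathrm{ord}(\omega)\big)$; (2) there exists an element $h(x)\in\mathbb{F}_0[[x]]$ such that $g(x)=g_0\cdot\dfrac{h(x)}{h(F(x))}$. Indeed, when $\big(g(x),F(x)\big)$ has finite order, setting $\widehat{g}(x)=\frac{1}{g_0}g(x)$ and $b=\mathrm{ord}(F(x))$, one has $g(x)=g_0\cdot\frac{h(x)}{h(F(x))}$ for $$h(x)=\Big(\widehat{g}^{\frac1b}(x)\Big)^{b-1}\Big(\widehat{g}^{\frac1b}\big(F(x)\big)\Big)^{b-2}\Big(\widehat{g}^{\frac1b}\big(F^{(2)}(x)\big)\Big)^{b-3}\cdots\Big(\widehat{g}^{\frac1b}\big(F^{(b-2)}(x)\big)\Big).$$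
   Context: $\mathbb{F}_0[[x]]$ is the group, under multiplication, of formal power series over $\mathbb{F}$ with nonzero constant term. $\mathbb{F}_1[[x]]$ is the group, under composition, of formal power series $f_1x+f_2x^2+\cdots$ over $\mathbb{F}$ with $f_1\ne0$; its identity is $x$. $F^{(m)}$ denotes the $m$-fold composite of $F$ with itself ($F^{(0)}(x)=x$). The Riordan group $\mathcal{R}(\mathbb{F})$ is the set $\mathbb{F}_0[[x]]\times\mathbb{F}_1[[x]]$ with operation $\big(g(x),F(x)\big)\big(h(x),K(x)\big)=\big(g(x)\cdot h(F(x)),\,K(F(x))\big)$ and identity $(1,x)$. The order of a group element $\gamma$ is the least positive integer $n$ with $\gamma^n$ equal to the identity (infinite order if there is none). For a series $u(x)=1+b_1x+\cdots$ and a positive integer $m$, $u^{\frac1m}(x)$ denotes the unique $m$-th root of $u(x)$ of the form $1+c_1x+\cdots$. The displayed product for $h(x)$ is $\prod_{i=0}^{b-2}\big(\widehat{g}^{\frac1b}(F^{(i)}(x))\big)^{b-1-i}$, which is the empty product $1$ when $b=1$. *)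

theory Defs
  imports
    "HOL-Computational_Algebra.Formal_Power_Series"
    "HOL-Algebra.Multiplicative_Group"
begin

unbundle fps_syntax

definition nonzero_group :: "'a::field monoid" where
  "nonzero_group = \<lparr>carrier = UNIV - {0}, mult = (*), one = 1\<rparr>"

definition fps_mult_group :: "'a::field fps monoid" where
  "fps_mult_group = \<lparr>carrier = {g. g $ 0 \<noteq> 0}, mult = (*), one = 1\<rparr>"

(* F oo K is F(K(x)), so F [^] m in this group is the m-fold composite of F. *)
definition fps_comp_group :: "'a::field fps monoid" where
  "fps_comp_group = \<lparr>carrier = {F. F $ 0 = 0 \<and> F $ 1 \<noteq> 0}, mult = (oo), one = fps_X\<rparr>"

definition riordan_group :: "('a::field fps \<times> 'a fps) monoid" where
  "riordan_group =
    \<lparr>carrier = carrier fps_mult_group \<times> carrier fps_comp_group,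
     mult = (\<lambda>(g, F) (h, K). (g * (h oo F), K oo F)),
     one = (1, fps_X)\<rparr>"

(* The unique m-th root with constant term 1; meaningful only for m > 0 and u $ 0 = 1. *)
definition fps_unit_root :: "nat \<Rightarrow> 'a::field_char_0 fps \<Rightarrow> 'a fps" where
  "fps_unit_root m u = (THE v. v $ 0 = 1 \<and> v ^ m = u)"

lemma fps_unit_root_unique:
  fixes u v :: "'a::field_char_0 fps"
  assumes "m > 0" and "u $ 0 = 1"
  shows "v $ 0 = 1 \<and> v ^ m = u \<longleftrightarrow> v = fps_radical (\<lambda>_ _. 1) m u"
proof -
  obtain k where m: "m = Suc k"
    using assms(1) gr0_conv_Suc by blast
  show ?thesis
    using radical_unique[of "\<lambda>_ _. 1" k u v] power_radical[of u "\<lambda>_ _. 1" k] assms(2)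
    unfolding m by auto
qed

lemma fps_unit_root_eq_radical:
  assumes "m > 0" and "u $ 0 = 1"
  shows "fps_unit_root m u = fps_radical (\<lambda>_ _. 1) m u"
  unfolding fps_unit_root_def fps_unit_root_unique[OF assms] by simp

lemma fps_unit_root:
  assumes "m > 0" and "u $ 0 = 1"
  shows "fps_unit_root m u $ 0 = 1" and "fps_unit_root m u ^ m = u"
  using fps_unit_root_unique[OF assms] fps_unit_root_eq_radical[OF assms] by auto

lemma group_nonzero_group: "group (nonzero_group :: 'a::field monoid)"
  by (rule groupI) (auto simp: nonzero_group_def intro: left_inverse)

lemma group_fps_mult_group: "group (fps_mult_group :: 'a::field fps monoid)"
proof (rule groupI)
  fix g :: "'a fps"
  assume "g \<in> carrier fps_mult_group"
  then show "\<exists>h \<in> carrier fps_mult_group.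
      h \<otimes>\<^bsub>fps_mult_group\<^esub> g = \<one>\<^bsub>fps_mult_group\<^esub>"
    by (intro bexI[of _ "inverse g"]) (auto simp: fps_mult_group_def inverse_mult_eq_1)
qed (auto simp: fps_mult_group_def mult.assoc)

lemma fps_compose_nth_1:
  fixes F K :: "'a::field fps"
  assumes "K $ 0 = 0"
  shows "(F oo K) $ 1 = F $ 1 * K $ 1"
  using assms by (simp add: fps_compose_nth)

lemma fps_inv_nth_0: "fps_inv F $ 0 = (0 :: 'a::field)"
  by (simp add: fps_inv_def)

lemma fps_inv_nth_1: "fps_inv F $ 1 = (1 / F $ 1 :: 'a::field)"
  by (simp add: fps_inv_def)

lemma group_fps_comp_group: "group (fps_comp_group :: 'a::field fps monoid)"
proof (rule groupI)
  fix F :: "'a fps"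
  assume "F \<in> carrier fps_comp_group"
  then show "\<exists>K \<in> carrier fps_comp_group.
      K \<otimes>\<^bsub>fps_comp_group\<^esub> F = \<one>\<^bsub>fps_comp_group\<^esub>"
    by (intro bexI[of _ "fps_inv F"])
      (auto simp: fps_comp_group_def fps_inv fps_inv_nth_0 fps_inv_nth_1 simp del: One_nat_def)
qed (auto simp: fps_comp_group_def fps_compose_nth_1 fps_compose_assoc simp del: One_nat_def)

lemma group_riordan_group: "group (riordan_group :: ('a::field fps \<times> 'a fps) monoid)"
proof (rule groupI)
  fix x :: "'a fps \<times> 'a fps"
  assume "x \<in> carrier riordan_group"
  then obtain g F where x: "x = (g, F)" and g: "g $ 0 \<noteq> 0" and F: "F $ 0 = 0" "F $ 1 \<noteq> 0"
    by (auto simp: riordan_group_def fps_mult_group_def fps_comp_group_def)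
  have "(inverse g oo fps_inv F) * (g oo fps_inv F) = 1"
    using g by (simp add: fps_inv_nth_0 inverse_mult_eq_1 flip: fps_compose_mult_distrib)
  then show "\<exists>y \<in> carrier riordan_group.
      y \<otimes>\<^bsub>riordan_group\<^esub> x = \<one>\<^bsub>riordan_group\<^esub>"
    using g F unfolding x
    by (intro bexI[of _ "(inverse g oo fps_inv F, fps_inv F)"])
      (auto simp: riordan_group_def fps_mult_group_def fps_comp_group_def fps_inv_right
        fps_inv_nth_0 fps_inv_nth_1 simp del: One_nat_def)
qed (auto simp: riordan_group_def fps_mult_group_def fps_comp_group_def fps_compose_nth_1
    fps_compose_assoc fps_compose_mult_distrib mult.assoc simp del: One_nat_def)

(* The library's ord is 0 exactly for elements of infinite order (ord_eq_0); otherwise it is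
   the least positive exponent that gives the identity. *)
lemma (in group) ord_eq_iff_least:
  assumes "x \<in> carrier G" and "n > 0"
  shows "ord x = n \<longleftrightarrow> x [^] n = \<one> \<and> (\<forall>m. 0 < m \<and> m < n \<longrightarrow> x [^] m \<noteq> \<one>)"
proof
  assume "ord x = n"
  then show "x [^] n = \<one> \<and> (\<forall>m. 0 < m \<and> m < n \<longrightarrow> x [^] m \<noteq> \<one>)"
    using assms pow_eq_id[OF assms(1)] by (auto dest: dvd_imp_le)
next
  assume least: "x [^] n = \<one> \<and> (\<forall>m. 0 < m \<and> m < n \<longrightarrow> x [^] m \<noteq> \<one>)"
  then have "ord x dvd n"
    using pow_eq_id[OF assms(1)] by simp
  then have "0 < ord x" "ord x \<le> n"
    using assms(2) by (auto intro: dvd_imp_le dvd_pos_nat)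
  then show "ord x = n"
    using least pow_ord_eq_1[OF assms(1)] by (meson le_neq_implies_less)
qed

end

theory Submission
  imports Defs
begin

text \<open>
  Write \<open>F\<^sub>i\<close> for the \<open>i\<close>-fold composite of \<open>F\<close> and \<open>N\<^sub>m(u) = u \<cdot> u(F) \<cdots> u(F\<^sub>m\<^sub>-\<^sub>1)\<close> for the product of
  \<open>u\<close> along the orbit of \<open>F\<close>. The theorem is a multiplicative Hilbert 90 for the action of the
  finite cyclic group generated by \<open>F\<close>, because \<open>(g, F)\<^sup>m = (N\<^sub>m(g), F\<^sub>m)\<close>
  (\<open>riordan_group_pow\<close>).

  A power \<open>m\<close> that kills \<open>(g, F)\<close> must be a multiple \<open>b \<cdot> k\<close> of the order \<open>b\<close> of \<open>F\<close>, and then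
  \<open>N\<^sub>m(g) = N\<^sub>b(g)\<^sup>k = g\<^sub>0\<^sup>m \<cdot> N\<^sub>b(u)\<^sup>k\<close> with \<open>u = g / g\<^sub>0\<close>. The series \<open>N\<^sub>b(u)\<close> has constant term 1, and
  in characteristic 0 no such series other than 1 is a root of unity. So the power is trivial
  exactly when \<open>ord(g\<^sub>0)\<close> divides \<open>m\<close> and \<open>N\<^sub>b(u) = 1\<close>. Hence the order of \<open>(g, F)\<close> is
  \<open>lcm(ord(g\<^sub>0), b)\<close> if \<open>N\<^sub>b(u) = 1\<close> and infinite otherwise (\<open>riordan_group_ord\<close>).

  It remains to see that \<open>N\<^sub>b(u) = 1\<close> is equivalent to \<open>u = h / h(F)\<close> for some \<open>h\<close>. If \<open>u\<close> has this
  form, the product \<open>N\<^sub>b(u)\<close> telescopes to \<open>h / h(F\<^sub>b) = 1\<close> (\<open>orbit_prod_coboundary\<close>). Conversely, let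
  \<open>r\<close> be the \<open>b\<close>-th root of \<open>u\<close> with constant term 1; then \<open>N\<^sub>b(r) = 1\<close> as well, and
  \<open>h = N\<^sub>1(r) \<cdots> N\<^sub>b\<^sub>-\<^sub>1(r)\<close>, which is the displayed product, satisfies \<open>r\<^sup>b \<cdot> h(F) = h\<close>
  (\<open>weighted_orbit_prod_solves\<close>).

  Finally \<open>F\<close> and its linear coefficient have the same order, because a series \<open>x + \<cdots>\<close> of finite
  compositional order in characteristic 0 is the identity (\<open>fps_eq_X_if_finite_order\<close>).
\<close>

section \<open>Iterated composition\<close>

abbreviation fps_iter :: "'a::field fps \<Rightarrow> nat \<Rightarrow> 'a fps" where
  "fps_iter F i \<equiv> F [^]\<^bsub>fps_comp_group\<^esub> i"

lemma fps_comp_group_one [simp]: "\<one>\<^bsub>fps_comp_group\<^esub> = fps_X"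
  by (simp add: fps_comp_group_def)

lemma fps_comp_group_mult [simp]: "F \<otimes>\<^bsub>fps_comp_group\<^esub> K = F oo K"
  by (simp add: fps_comp_group_def)

lemma fps_iter_Suc2:
  assumes "F \<in> carrier fps_comp_group"
  shows "fps_iter F (Suc i) = F oo fps_iter F i"
proof -
  interpret group "fps_comp_group :: 'a fps monoid"
    by (rule group_fps_comp_group)
  show ?thesis
    using nat_pow_Suc2[OF assms, of i] by (simp add: fps_comp_group_def)
qed

lemma fps_iter_nth_0:
  assumes "F $ 0 = 0"
  shows "fps_iter F i $ 0 = 0"
  using assms by (induction i) simp_all

lemma fps_iter_nth_1:
  assumes "F $ 0 = 0"
  shows "fps_iter F i $ 1 = (F $ 1) ^ i"
  using assms
  by (induction i) (simp_all add: fps_compose_nth_1 del: One_nat_def)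

lemma fps_iter_X: "fps_iter fps_X i = fps_X"
  by (induction i) simp_all

section \<open>Orders in the group of units and in the composition group\<close>

lemma nonzero_group_pow: "x [^]\<^bsub>nonzero_group\<^esub> (m::nat) = x ^ m"
  by (induction m) (simp_all add: nonzero_group_def nat_pow_def)

lemma nonzero_group_ord_dvd_iff:
  assumes "x \<noteq> 0"
  shows "group.ord nonzero_group x dvd m \<longleftrightarrow> x ^ m = 1"
  using group.pow_eq_id[OF group_nonzero_group, of x m] assms
  by (simp add: nonzero_group_pow) (simp add: nonzero_group_def)

lemma fps_comp_group_ord_dvd_iff:
  assumes "F \<in> carrier fps_comp_group"
  shows "group.ord fps_comp_group F dvd m \<longleftrightarrow> fps_iter F m = fps_X"
  using group.pow_eq_id[OF group_fps_comp_group assms, of m]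
  by (simp add: fps_comp_group_def)

text \<open>
  The sum \<open>L\<close> of all iterates of \<open>K\<close> is invariant, \<open>L(K) = L\<close>, since composing with \<open>K\<close> only permutes
  the summands. Its linear coefficient is \<open>k \<noteq> 0\<close>, so \<open>L\<close> has a compositional inverse and can be
  cancelled on the left.
\<close>
lemma fps_eq_X_if_finite_order:
  fixes K :: "'a::field_char_0 fps"
  assumes K0: "K $ 0 = 0" and K1: "K $ 1 = 1" and k: "k > 0" and per: "fps_iter K k = fps_X"
  shows "K = fps_X"
proof -
  define L where "L = (\<Sum>i<k. fps_iter K i)"
  have L0: "L $ 0 = 0"
    by (simp add: L_def fps_sum_nth fps_iter_nth_0[OF K0])
  have "L $ 1 = of_nat k"
    by (simp add: L_def fps_sum_nth fps_iter_nth_1[OF K0] K1 del: One_nat_def)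
  then have L1: "L $ 1 \<noteq> 0"
    using k by simp
  have "L oo K = (\<Sum>i<k. fps_iter K (Suc i))"
    by (simp add: L_def fps_compose_sum_distrib)
  also have "\<dots> = L"
    using sum.lessThan_Suc_shift[of "fps_iter K" k] sum.lessThan_Suc[of "fps_iter K" k]
    by (simp add: L_def per)
  finally have invar: "L oo K = L" .
  have "K = (fps_inv L oo L) oo K"
    using K0 by (simp add: fps_inv[OF L0 L1])
  also have "\<dots> = fps_inv L oo (L oo K)"
    using K0 L0 by (simp add: fps_compose_assoc)
  also have "\<dots> = fps_X"
    by (simp add: invar fps_inv[OF L0 L1])
  finally show ?thesis .
qed

text \<open>
  If \<open>c\<close> is the order of the linear coefficient, the \<open>c\<close>-fold composite of \<open>F\<close> starts with \<open>x\<close> and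
  still has finite order, hence is the identity.
\<close>
lemma fps_comp_group_ord_eq_ord_nth_1:
  fixes F :: "'a::field_char_0 fps"
  assumes F: "F \<in> carrier fps_comp_group" and fin: "group.ord fps_comp_group F \<noteq> 0"
  shows "group.ord fps_comp_group F = group.ord nonzero_group (F $ 1)"
proof (rule dvd_antisym)
  let ?b = "group.ord fps_comp_group F" and ?c = "group.ord nonzero_group (F $ 1)"
  interpret C: group "fps_comp_group :: 'a fps monoid"
    by (rule group_fps_comp_group)
  have F0: "F $ 0 = 0" and F1: "F $ 1 \<noteq> 0"
    using F by (auto simp: fps_comp_group_def)
  have per: "fps_iter F ?b = fps_X"
    using fps_comp_group_ord_dvd_iff[OF F, of ?b] by simp
  then show "?c dvd ?b"
    using fps_iter_nth_1[OF F0, of ?b] nonzero_group_ord_dvd_iff[OF F1] by simp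
  have "fps_iter F ?c = fps_X"
  proof (rule fps_eq_X_if_finite_order)
    show "fps_iter F ?c $ 0 = 0"
      by (rule fps_iter_nth_0[OF F0])
    show "fps_iter F ?c $ 1 = 1"
      using fps_iter_nth_1[OF F0, of ?c] nonzero_group_ord_dvd_iff[OF F1, of ?c] by simp
    have "fps_iter (fps_iter F ?c) ?b = fps_iter (fps_iter F ?b) ?c"
      unfolding C.nat_pow_pow[OF F] by (simp only: mult.commute)
    then show "fps_iter (fps_iter F ?c) ?b = fps_X"
      by (simp add: per fps_iter_X)
  qed (use fin in simp)
  then show "?b dvd ?c"
    using fps_comp_group_ord_dvd_iff[OF F] by simp
qed

text \<open>
  Both \<open>v\<close> and 1 are \<open>k\<close>-th roots of 1 with constant term 1, and such a root is unique in
  characteristic 0.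
\<close>
lemma fps_eq_1_if_power_eq_1:
  fixes v :: "'a::field_char_0 fps"
  assumes "v $ 0 = 1" and "k > 0" and "v ^ k = 1"
  shows "v = 1"
  using fps_unit_root_unique[of k 1 v] fps_unit_root_unique[of k 1 1] assms by simp

section \<open>Products along an orbit\<close>

definition orbit_prod :: "'a::field fps \<Rightarrow> nat \<Rightarrow> 'a fps \<Rightarrow> 'a fps" where
  "orbit_prod F m u = (\<Prod>i<m. u oo fps_iter F i)"

lemma orbit_prod_Suc:
  "orbit_prod F (Suc m) u = orbit_prod F m u * (u oo fps_iter F m)"
  by (simp add: orbit_prod_def mult.commute)

lemma orbit_prod_Suc_shift:
  assumes "F $ 0 = 0"
  shows "orbit_prod F (Suc m) u = u * (orbit_prod F m u oo F)"
  unfolding orbit_prod_def prod.lessThan_Suc_shift fps_compose_prod_distrib[OF assms]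
  using assms by (simp add: fps_compose_assoc fps_iter_nth_0)

lemma orbit_prod_mult:
  assumes "F $ 0 = 0"
  shows "orbit_prod F m (u * v) = orbit_prod F m u * orbit_prod F m v"
  by (simp add: orbit_prod_def fps_compose_mult_distrib fps_iter_nth_0[OF assms] prod.distrib)

lemma orbit_prod_const: "orbit_prod F m (fps_const c) = fps_const (c ^ m)"
  by (simp add: orbit_prod_def fps_const_power)

lemma orbit_prod_power:
  assumes "F $ 0 = 0"
  shows "orbit_prod F m (u ^ k) = orbit_prod F m u ^ k"
  by (simp add: orbit_prod_def fps_compose_power fps_iter_nth_0[OF assms] prod_power_distrib)

lemma orbit_prod_nth_0: "orbit_prod F m u $ 0 = (u $ 0) ^ m"
  by (induction m) (simp_all add: orbit_prod_def mult.commute)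

text \<open>
  The hypothesis on \<open>u\<close> says \<open>u = h / h(F)\<close>, so that the product telescopes; stating it without a
  quotient makes the induction free of divisions.
\<close>
lemma orbit_prod_coboundary:
  assumes F0: "F $ 0 = 0" and per: "fps_iter F m = fps_X"
    and h0: "h $ 0 \<noteq> 0" and u: "u * (h oo F) = h"
  shows "orbit_prod F m u = 1"
proof -
  have "orbit_prod F k u * (h oo fps_iter F k) = h" for k
  proof (induction k)
    case 0
    then show ?case by (simp add: orbit_prod_def)
  next
    case (Suc k)
    have "orbit_prod F (Suc k) u * (h oo fps_iter F (Suc k))
        = u * ((orbit_prod F k u * (h oo fps_iter F k)) oo F)"
      using F0
      by (simp add: orbit_prod_Suc_shift fps_compose_assoc fps_iter_nth_0
          fps_compose_mult_distrib mult.assoc)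
    then show ?case by (simp add: Suc.IH u)
  qed
  from this[of m] have "orbit_prod F m u * h = 1 * h"
    by (simp add: per)
  moreover have "h \<noteq> 0"
    using h0 by auto
  ultimately show ?thesis
    by (metis mult_right_cancel)
qed

text \<open>
  By \<open>weighted_orbit_prod_Suc\<close> below, this is the product of \<open>orbit_prod F j u\<close> over
  \<open>1 \<le> j \<le> m\<close>, collected by the factors \<open>u(F\<^sub>i)\<close>. For \<open>m = b - 1\<close> and \<open>u\<close> the \<open>b\<close>-th root it is
  the explicit solution \<open>h\<close>.
\<close>
definition weighted_orbit_prod :: "'a::field fps \<Rightarrow> nat \<Rightarrow> 'a fps \<Rightarrow> 'a fps" where
  "weighted_orbit_prod F m u = (\<Prod>i<m. (u oo fps_iter F i) ^ (m - i))"

lemma weighted_orbit_prod_Suc: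
  "weighted_orbit_prod F (Suc m) u = weighted_orbit_prod F m u * orbit_prod F (Suc m) u"
proof -
  have "(\<Prod>i<m. (u oo fps_iter F i) ^ (Suc m - i))
      = (\<Prod>i<m. (u oo fps_iter F i) ^ (m - i) * (u oo fps_iter F i))"
    by (intro prod.cong) (simp_all add: Suc_diff_le)
  then show ?thesis
    by (simp add: weighted_orbit_prod_def orbit_prod_def prod.distrib mult.assoc)
qed

text \<open>
  Each factor obeys \<open>u \<cdot> N\<^sub>j(u)(F) = N\<^sub>j\<^sub>+\<^sub>1(u)\<close>. Over \<open>1 \<le> j \<le> m\<close> this uses \<open>m\<close> of the factors \<open>u\<close> and
  shifts the index range to \<open>2 \<le> j \<le> m + 1\<close>; the remaining factor \<open>u = N\<^sub>1(u)\<close> fills the gap at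
  the bottom, leaving \<open>N\<^sub>m\<^sub>+\<^sub>1(u)\<close> as surplus at the top.
\<close>
lemma weighted_orbit_prod_compose:
  assumes F0: "F $ 0 = 0"
  shows "u ^ Suc m * (weighted_orbit_prod F m u oo F)
    = weighted_orbit_prod F m u * orbit_prod F (Suc m) u"
proof (induction m)
  case 0
  then show ?case by (simp add: weighted_orbit_prod_def orbit_prod_def)
next
  case (Suc m)
  have "u ^ Suc (Suc m) * (weighted_orbit_prod F (Suc m) u oo F)
      = (u ^ Suc m * (weighted_orbit_prod F m u oo F)) * (u * (orbit_prod F (Suc m) u oo F))"
    by (simp add: weighted_orbit_prod_Suc fps_compose_mult_distrib[OF F0] mult_ac)
  also have "\<dots> = weighted_orbit_prod F (Suc m) u * orbit_prod F (Suc (Suc m)) u"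
    by (simp only: Suc.IH orbit_prod_Suc_shift[OF F0, symmetric] weighted_orbit_prod_Suc)
  finally show ?case .
qed

lemma weighted_orbit_prod_nth_0:
  assumes "u $ 0 = 1"
  shows "weighted_orbit_prod F m u $ 0 = 1"
  using assms by (induction m)
    (simp_all add: weighted_orbit_prod_Suc orbit_prod_nth_0, simp add: weighted_orbit_prod_def)

text \<open>
  The orbit product of the root is a \<open>b\<close>-th root of 1 with constant term 1, hence equals 1. For
  \<open>m = b - 1\<close> the surplus factor in \<open>weighted_orbit_prod_compose\<close> is this orbit product.
\<close>
lemma weighted_orbit_prod_solves:
  fixes F u :: "'a::field_char_0 fps"
  assumes F0: "F $ 0 = 0" and b: "b > 0" and u0: "u $ 0 = 1"
    and norm: "orbit_prod F b u = 1"
  defines "h \<equiv> weighted_orbit_prod F (b - 1) (fps_unit_root b u)"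
  shows "h $ 0 = 1" and "u * (h oo F) = h"
proof -
  let ?r = "fps_unit_root b u"
  have r0: "?r $ 0 = 1" and r: "?r ^ b = u"
    using fps_unit_root[OF b u0] by auto
  show "h $ 0 = 1"
    unfolding h_def by (rule weighted_orbit_prod_nth_0[OF r0])
  have "orbit_prod F b ?r = 1"
  proof (rule fps_eq_1_if_power_eq_1)
    show "orbit_prod F b ?r ^ b = 1"
      by (simp add: r norm flip: orbit_prod_power[OF F0])
  qed (use b r0 in \<open>simp_all add: orbit_prod_nth_0\<close>)
  then show "u * (h oo F) = h"
    using weighted_orbit_prod_compose[OF F0, of ?r "b - 1"] b r by (simp add: h_def)
qed

section \<open>Powers and orders in the Riordan group\<close>

lemma riordan_group_one [simp]: "\<one>\<^bsub>riordan_group\<^esub> = (1, fps_X)"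
  by (simp add: riordan_group_def)

lemma riordan_group_mult [simp]:
  "(g, F) \<otimes>\<^bsub>riordan_group\<^esub> (h, K) = (g * (h oo F), K oo F)"
  by (simp add: riordan_group_def)

lemma riordan_group_pow:
  assumes "F \<in> carrier fps_comp_group"
  shows "(g, F) [^]\<^bsub>riordan_group\<^esub> m = (orbit_prod F m g, fps_iter F m)"
proof (induction m)
  case 0
  then show ?case by (simp add: orbit_prod_def)
next
  case (Suc m)
  have "fps_iter F m oo F = F oo fps_iter F m"
    using fps_iter_Suc2[OF assms, of m] by simp
  then show ?case by (simp add: Suc.IH orbit_prod_Suc)
qed

text \<open>
  The second component forces \<open>b\<close> to divide \<open>m\<close>. Since \<open>(g, F)\<^sup>b\<close> has second component \<open>x\<close>, its
  further powers are ordinary powers of series. Comparing constant terms then separates the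
  condition on \<open>g\<^sub>0\<close> from that on the normalised series \<open>g / g\<^sub>0\<close>; the latter condition loses its
  exponent by \<open>fps_eq_1_if_power_eq_1\<close>. The case
  \<open>m = 0\<close> is excluded because the zeroth power is trivial for every \<open>g\<close>.
\<close>
lemma riordan_group_pow_eq_one_iff:
  fixes g F :: "'a::field_char_0 fps"
  assumes g: "g \<in> carrier fps_mult_group" and F: "F \<in> carrier fps_comp_group"
    and m: "m > 0"
  defines "b \<equiv> group.ord fps_comp_group F"
  shows "(g, F) [^]\<^bsub>riordan_group\<^esub> m = \<one>\<^bsub>riordan_group\<^esub> \<longleftrightarrow>
    b dvd m \<and> group.ord nonzero_group (g $ 0) dvd m
      \<and> orbit_prod F b (fps_const (1 / g $ 0) * g) = 1"
proof (cases "b dvd m")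
  case False
  then show ?thesis
    using fps_comp_group_ord_dvd_iff[OF F, of m]
    by (simp add: riordan_group_pow[OF F] b_def)
next
  case True
  interpret R: group "riordan_group :: ('a fps \<times> 'a fps) monoid"
    by (rule group_riordan_group)
  let ?u = "fps_const (1 / g $ 0) * g"
  let ?N = "orbit_prod F b ?u"
  from True obtain k where k: "m = b * k" ..
  have k0: "k > 0"
    using k m by (cases k) auto
  have F0: "F $ 0 = 0" and g0: "g $ 0 \<noteq> 0"
    using F g by (auto simp: fps_comp_group_def fps_mult_group_def)
  have X: "fps_X \<in> carrier (fps_comp_group :: 'a fps monoid)"
    by (simp add: fps_comp_group_def)
  have per: "fps_iter F b = fps_X"
    using fps_comp_group_ord_dvd_iff[OF F, of b] by (simp add: b_def)
  have "fps_const (g $ 0) * fps_const (1 / g $ 0) = 1"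
    using g0 by simp
  then have "fps_const (g $ 0) * ?u = g"
    by (simp only: mult.assoc[symmetric] mult_1)
  then have N: "orbit_prod F b g = fps_const ((g $ 0) ^ b) * ?N"
    using orbit_prod_mult[OF F0, of b "fps_const (g $ 0)" ?u] by (simp only: orbit_prod_const)
  have N0: "?N $ 0 = 1"
    using g0 by (simp add: orbit_prod_nth_0)
  have "(g, F) [^]\<^bsub>riordan_group\<^esub> m
      = (orbit_prod F b g, fps_X) [^]\<^bsub>riordan_group\<^esub> k"
  proof -
    have "(g, F) \<in> carrier riordan_group"
      using g F by (simp add: riordan_group_def)
    from R.nat_pow_pow[OF this, of b k] show ?thesis
      unfolding k riordan_group_pow[OF F, of g b] per by (rule sym)
  qed
  also have "\<dots> = (orbit_prod F b g ^ k, fps_X)"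
    by (simp add: riordan_group_pow[OF X] fps_iter_X orbit_prod_def)
  also have "orbit_prod F b g ^ k = fps_const ((g $ 0) ^ m) * ?N ^ k"
    by (simp add: N power_mult_distrib k power_mult fps_const_power)
  finally have pow: "(g, F) [^]\<^bsub>riordan_group\<^esub> m = (fps_const ((g $ 0) ^ m) * ?N ^ k, fps_X)" .
  have "fps_const ((g $ 0) ^ m) * ?N ^ k = 1 \<longleftrightarrow> (g $ 0) ^ m = 1 \<and> ?N = 1"
  proof
    assume eq: "fps_const ((g $ 0) ^ m) * ?N ^ k = 1"
    have "(fps_const ((g $ 0) ^ m) * ?N ^ k) $ 0 = (g $ 0) ^ m"
      using N0 by (simp add: fps_nth_power_0)
    with eq have c: "(g $ 0) ^ m = 1"
      by simp
    then have "?N ^ k = 1"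
      using eq by simp
    with c show "(g $ 0) ^ m = 1 \<and> ?N = 1"
      using fps_eq_1_if_power_eq_1[OF N0 k0] by simp
  qed simp
  then show ?thesis
    using True nonzero_group_ord_dvd_iff[OF g0, of m] by (simp add: pow)
qed

text \<open>
  An order is determined by its multiples. The value 0 stands for infinite order, and 0 divides
  only the exponent 0.
\<close>
lemma riordan_group_ord:
  fixes g F :: "'a::field_char_0 fps"
  assumes g: "g \<in> carrier fps_mult_group" and F: "F \<in> carrier fps_comp_group"
  defines "b \<equiv> group.ord fps_comp_group F"
  shows "group.ord riordan_group (g, F) =
    (if orbit_prod F b (fps_const (1 / g $ 0) * g) = 1
     then lcm (group.ord nonzero_group (g $ 0)) b else 0)"
    (is "?o = ?d")
proof -
  interpret R: group "riordan_group :: ('a fps \<times> 'a fps) monoid"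
    by (rule group_riordan_group)
  have "(g, F) \<in> carrier riordan_group"
    using g F by (simp add: riordan_group_def)
  then have dvd_iff: "?o dvd m \<longleftrightarrow> ?d dvd m" for m
    using riordan_group_pow_eq_one_iff[OF g F, of m]
    by (cases "m = 0") (auto simp: R.pow_eq_id[symmetric] b_def)
  from dvd_iff[of ?d] dvd_iff[of ?o] show ?thesis
    by (intro dvd_antisym) (simp_all only: dvd_refl)
qed

section \<open>The order criterion\<close>

lemma fps_eq_const_mult_quotient_iff:
  fixes g h F :: "'a::field fps"
  assumes "c \<noteq> 0" and "h $ 0 \<noteq> 0"
  shows "g = fps_const c * (h / (h oo F)) \<longleftrightarrow> fps_const (1 / c) * g * (h oo F) = h"
proof -
  have unit: "(h oo F) * inverse (h oo F) = 1"
    using assms(2) by (simp add: inverse_mult_eq_1')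
  have quot: "h / (h oo F) = h * inverse (h oo F)"
    using assms(2) by (simp add: fps_divide_unit)
  have cc: "fps_const (1 / c) * fps_const c = 1" "fps_const c * fps_const (1 / c) = 1"
    using assms(1) by simp_all
  show ?thesis
    unfolding quot
  proof
    assume "g = fps_const c * (h * inverse (h oo F))"
    then have "fps_const (1 / c) * g * (h oo F)
        = (fps_const (1 / c) * fps_const c) * h * ((h oo F) * inverse (h oo F))"
      by (simp only: mult_ac)
    then show "fps_const (1 / c) * g * (h oo F) = h"
      by (simp only: cc unit mult_1 mult_1_right)
  next
    assume "fps_const (1 / c) * g * (h oo F) = h"
    then have "fps_const c * (h * inverse (h oo F))
        = fps_const c * (fps_const (1 / c) * g * (h oo F) * inverse (h oo F))"
      by simp
    also have "\<dots> = (fps_const c * fps_const (1 / c)) * g * ((h oo F) * inverse (h oo F))"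
      by (simp only: mult_ac)
    finally show "g = fps_const c * (h * inverse (h oo F))"
      by (simp only: cc unit mult_1 mult_1_right)
  qed
qed

theorem theorem1:
  fixes g F :: "'a::field_char_0 fps" and n :: nat
  assumes g: "g \<in> carrier fps_mult_group"
    and g0_fin: "group.ord nonzero_group (g $ 0) \<noteq> 0"
    and F: "F \<in> carrier fps_comp_group"
    and F_fin: "group.ord fps_comp_group F \<noteq> 0"
    and n: "n > 0"
  shows "(group.ord riordan_group (g, F) = n \<longleftrightarrow>
           (n = lcm (group.ord nonzero_group (g $ 0)) (group.ord fps_comp_group F) \<and>
            n = lcm (group.ord nonzero_group (g $ 0)) (group.ord nonzero_group (F $ 1))) \<and>
           (\<exists>h \<in> carrier fps_mult_group. g = fps_const (g $ 0) * (h / (h oo F))))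
       \<and> (group.ord riordan_group (g, F) \<noteq> 0 \<longrightarrow>
           (let ghat = fps_const (1 / g $ 0) * g;
                b = group.ord fps_comp_group F;
                h = (\<Prod>i<b - 1. (fps_unit_root b ghat oo (F [^]\<^bsub>fps_comp_group\<^esub> i)) ^ (b - 1 - i))
            in h \<in> carrier fps_mult_group \<and> g = fps_const (g $ 0) * (h / (h oo F))))"
proof -
  define u where "u = fps_const (1 / g $ 0) * g"
  define b where "b = group.ord fps_comp_group F"
  define h where "h = weighted_orbit_prod F (b - 1) (fps_unit_root b u)"
  have g0: "g $ 0 \<noteq> 0" and F0: "F $ 0 = 0"
    using g F by (auto simp: fps_mult_group_def fps_comp_group_def)
  have u0: "u $ 0 = 1"
    using g0 by (simp add: u_def)
  have b: "b > 0"
    using F_fin by (simp add: b_def)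
  have per: "fps_iter F b = fps_X"
    using fps_comp_group_ord_dvd_iff[OF F, of b] by (simp add: b_def)
  have ord: "group.ord riordan_group (g, F) =
      (if orbit_prod F b u = 1 then lcm (group.ord nonzero_group (g $ 0)) b else 0)"
    using riordan_group_ord[OF g F] by (simp add: u_def b_def)
  have explicit: "h \<in> carrier fps_mult_group \<and> g = fps_const (g $ 0) * (h / (h oo F))"
    if "orbit_prod F b u = 1"
  proof -
    have "h $ 0 = 1" "u * (h oo F) = h"
      unfolding h_def by (rule weighted_orbit_prod_solves[OF F0 b u0 that])+
    then show ?thesis
      using fps_eq_const_mult_quotient_iff[OF g0, of h g F] by (simp add: fps_mult_group_def u_def)
  qed
  have converse: "orbit_prod F b u = 1"
    if "k \<in> carrier fps_mult_group" "g = fps_const (g $ 0) * (k / (k oo F))" for k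
  proof (rule orbit_prod_coboundary[OF F0 per])
    show k0: "k $ 0 \<noteq> 0"
      using that(1) by (simp add: fps_mult_group_def)
    show "u * (k oo F) = k"
      using fps_eq_const_mult_quotient_iff[OF g0 k0, of g F] that(2) unfolding u_def by blast
  qed
  have solvable: "orbit_prod F b u = 1 \<longleftrightarrow>
      (\<exists>h \<in> carrier fps_mult_group. g = fps_const (g $ 0) * (h / (h oo F)))"
    using explicit converse by blast
  have "group.ord riordan_group (g, F) = n \<longleftrightarrow>
      n = lcm (group.ord nonzero_group (g $ 0)) b \<and>
      (\<exists>h \<in> carrier fps_mult_group. g = fps_const (g $ 0) * (h / (h oo F)))"
    unfolding solvable[symmetric] ord using n by auto
  moreover have "h \<in> carrier fps_mult_group \<and> g = fps_const (g $ 0) * (h / (h oo F))"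
    if "group.ord riordan_group (g, F) \<noteq> 0"
    using explicit that unfolding ord by (simp split: if_splits)
  ultimately show ?thesis
    unfolding Let_def fps_comp_group_ord_eq_ord_nth_1[OF F F_fin, symmetric]
    unfolding b_def[symmetric] u_def[symmetric] weighted_orbit_prod_def[symmetric] h_def[symmetric]
    by blast
qed

end
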